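(* Let $p\ge 5$ be a prime and let $r$ be a nonzero integer relatively prime to $p$. Then there are at least $\frac12(p+1)$ linearly independent congruence relations mod $p$ of the form $$\sum_{j=0}^{p-1}\alpha_j\,\xi_r(pn+j)\equiv 0\pmod p\quad\text{for all integers } n\ge 0,$$ with $\vec\alpha=(\alpha_0,\dots,\alpha_{p-1})\in\mathbb{F}_p^{\,p}$. That is, there exist at least $\frac12(p+1)$ vectors $\vec\alpha\in\mathbb{F}_p^{\,p}$, linearly independent over $\mathbb{F}_p$, such that each of them satisfies the displayed congruence for every integer $n\ge0$.
   Context: For $n\ge 0$ let $(q;q)_n=\prod_{i=1}^n(1-q^i)$ (with $(q;q)_0=1$), and let $F(q)=\sum_{n=0}^\infty (q;q)_n$. For a nonzero integer $r$, the $r$-Fishburn numbers $\xi_r(n)\in\mathbb{Z}$ ($n\ge 0$) are defined by the formal power series identity $$\sum_{n=0}^\infty \xi_r(n)q^n = F((1-q)^r)=\sum_{n=0}^\infty\prod_{i=1}^n\left(1-(1-q)^{ri}\right),$$ where $(1-q)^{ri}$ is expanded as a formal power series in $q$ (the $n$-th summand is divisible by $q^n$, so the sum is well defined in $\mathbb{Z}[[q]]$). The vector $\vec\alpha$ in a relation does not depend on $n$. *)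

theory Defs
  imports
    "HOL-Computational_Algebra.Formal_Power_Series"
    "HOL-Number_Theory.Residues"
    "Jordan_Normal_Form.Missing_VectorSpace"
begin

section \<open>The power series \<open>F((1 - q)\<^sup>r)\<close> and the \<open>r\<close>-Fishburn numbers\<close>

definition qpoch :: "'a::comm_ring_1 \<Rightarrow> nat \<Rightarrow> 'a"
  where "qpoch u n = (\<Prod>i=1..n. 1 - u ^ i)"

text \<open>
  The infinite sum is the limit of the partial sums in the \<open>X\<close>-adic topology of the library on
  power series. As a power series in \<open>q\<close>, the sum \<open>F(q)\<close> itself diverges; \<open>fishburn_F u\<close> is
  only meaningful if the constant coefficient of \<open>u\<close> is 1 (see \<open>sums_fishburn_F\<close> below).
\<close>

definition fishburn_F :: "int fps \<Rightarrow> int fps"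
  where "fishburn_F u = (\<Sum>n. qpoch u n)"

text \<open>
  \<open>(1 - q)\<^sup>m\<close> for an integer exponent \<open>m\<close>. The type \<open>int fps\<close> has no \<open>inverse\<close>, hence no \<open>powi\<close>;
  the inverse of \<open>1 - q\<close> is the geometric series. The lemmas \<open>one_minus_q_powi_1\<close> and
  \<open>one_minus_q_powi_add\<close> characterise the function.
\<close>

definition one_minus_q_powi :: "int \<Rightarrow> int fps"
  where "one_minus_q_powi m =
    (if m \<ge> 0 then (1 - fps_X) ^ nat m else (Abs_fps (\<lambda>_. 1)) ^ nat (- m))"

definition fishburn :: "int \<Rightarrow> nat \<Rightarrow> int"
  where "fishburn r n = fps_nth (fishburn_F (one_minus_q_powi r)) n"

lemma geometric_inverse: "(1 - fps_X) * Abs_fps (\<lambda>_. 1 :: int) = 1"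
  by (rule fps_ext) (simp add: algebra_simps)

lemma one_minus_q_powi_0: "one_minus_q_powi 0 = 1"
  by (simp add: one_minus_q_powi_def)

lemma one_minus_q_powi_1: "one_minus_q_powi 1 = 1 - fps_X"
  by (simp add: one_minus_q_powi_def)

lemma one_minus_q_powi_Suc:
  "one_minus_q_powi (m + 1) = (1 - fps_X) * one_minus_q_powi m"
proof (cases "m \<ge> 0")
  case True
  then show ?thesis
    by (simp add: one_minus_q_powi_def nat_add_distrib)
next
  case False
  then have "nat (- m) = Suc (nat (- (m + 1)))" by simp
  then have "(1 - fps_X) * one_minus_q_powi m = Abs_fps (\<lambda>_. 1) ^ nat (- (m + 1))"
    using False geometric_inverse
    by (simp add: one_minus_q_powi_def mult.assoc [symmetric])
  also have "\<dots> = one_minus_q_powi (m + 1)"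
    using False by (cases "m = - 1") (auto simp: one_minus_q_powi_def)
  finally show ?thesis ..
qed

lemma one_minus_q_powi_add:
  "one_minus_q_powi (m + k) = one_minus_q_powi m * one_minus_q_powi k"
proof (induction k rule: int_induct [where k = 0])
  case base
  show ?case by (simp add: one_minus_q_powi_0)
next
  case (step1 i)
  then show ?case
    using one_minus_q_powi_Suc [of "m + i"] one_minus_q_powi_Suc [of i]
    by (simp add: add.assoc mult.left_commute)
next
  case (step2 i)
  have "(1 - fps_X) * one_minus_q_powi (m + (i - 1))
      = (1 - fps_X) * (one_minus_q_powi m * one_minus_q_powi (i - 1))"
    using one_minus_q_powi_Suc [of "m + (i - 1)"] one_minus_q_powi_Suc [of "i - 1"] step2
    by (simp add: add.assoc mult.left_commute)
  then have "Abs_fps (\<lambda>_. 1) * (1 - fps_X) * one_minus_q_powi (m + (i - 1))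
      = Abs_fps (\<lambda>_. 1) * (1 - fps_X) * (one_minus_q_powi m * one_minus_q_powi (i - 1))"
    by (simp only: mult.assoc)
  then show ?case
    using geometric_inverse by (simp only: mult.commute [of "Abs_fps _"] mult_1_left)
qed

lemma one_minus_q_powi_mult: "one_minus_q_powi (r * int i) = one_minus_q_powi r ^ i"
  by (induction i) (simp_all add: one_minus_q_powi_0 one_minus_q_powi_add algebra_simps)

lemma one_minus_q_powi_nth_0: "fps_nth (one_minus_q_powi m) 0 = 1"
  by (simp add: one_minus_q_powi_def fps_power_zeroth)

lemma fps_nth_qpoch_eq_0:
  fixes u :: "'a::comm_ring_1 fps"
  assumes "fps_nth u 0 = 1" "k < n"
  shows "fps_nth (qpoch u n) k = 0"
proof -
  have "\<exists>g. qpoch u n = fps_X ^ n * g"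
  proof (induction n)
    case 0
    show ?case by (simp add: qpoch_def)
  next
    case (Suc n)
    then obtain g where g: "qpoch u n = fps_X ^ n * g" by blast
    have "1 - u ^ Suc n = fps_X * fps_shift 1 (1 - u ^ Suc n)"
      by (rule fps_ext) (use assms(1) in \<open>simp add: fps_power_zeroth\<close>)
    moreover have "qpoch u (Suc n) = qpoch u n * (1 - u ^ Suc n)"
      by (simp add: qpoch_def mult.commute)
    ultimately have "qpoch u (Suc n) = fps_X ^ n * g * (fps_X * fps_shift 1 (1 - u ^ Suc n))"
      using g by simp
    also have "\<dots> = fps_X ^ Suc n * (g * fps_shift 1 (1 - u ^ Suc n))"
      by (simp only: power_Suc mult_ac)
    finally show ?case by blast
  qed
  then show ?thesis
    using assms(2) by (auto simp: fps_X_power_mult_nth)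
qed

lemma sums_fishburn_F:
  assumes "fps_nth u 0 = 1"
  shows "qpoch u sums fishburn_F u"
    and "fps_nth (fishburn_F u) k = (\<Sum>n\<le>k. fps_nth (qpoch u n) k)"
proof -
  define S where "S = Abs_fps (\<lambda>k. \<Sum>n\<le>k. fps_nth (qpoch u n) k)"
  have "qpoch u sums S"
    unfolding sums_def
  proof (rule tendsto_fpsI)
    fix k
    have "fps_nth (\<Sum>n<N. qpoch u n) k = fps_nth S k" if "N > k" for N
    proof -
      have "fps_nth (\<Sum>n<N. qpoch u n) k = (\<Sum>n<N. fps_nth (qpoch u n) k)"
        by (simp add: fps_sum_nth)
      also have "\<dots> = (\<Sum>n\<le>k. fps_nth (qpoch u n) k)"
        using that assms by (intro sum.mono_neutral_right) (auto simp: fps_nth_qpoch_eq_0)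
      finally show ?thesis by (simp add: S_def)
    qed
    then show "\<forall>\<^sub>F N in sequentially. fps_nth (\<Sum>n<N. qpoch u n) k = fps_nth S k"
      using eventually_gt_at_top [of k] by (rule eventually_mono [rotated])
  qed
  then show "qpoch u sums fishburn_F u"
    and "fps_nth (fishburn_F u) k = (\<Sum>n\<le>k. fps_nth (qpoch u n) k)"
    by (simp_all add: fishburn_F_def sums_unique [symmetric] S_def)
qed

theorem fishburn_generating_function:
  "(\<lambda>n. \<Prod>i=1..n. 1 - one_minus_q_powi (r * int i)) sums Abs_fps (fishburn r)"
proof -
  have "Abs_fps (fishburn r) = fishburn_F (one_minus_q_powi r)"
    by (rule fps_ext) (simp add: fishburn_def)
  then show ?thesis
    using sums_fishburn_F(1) [OF one_minus_q_powi_nth_0, of r]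
    by (simp add: qpoch_def [abs_def] one_minus_q_powi_mult)
qed

section \<open>The vector space \<open>F\<^sub>p\<^sup>p\<close>\<close>

text \<open>
  \<open>F\<^sub>p\<close> is the library's \<open>residue_ring p\<close>, with carrier \<open>{0..p - 1}\<close>; vectors are the extensional
  functions from \<open>{..<p}\<close> to it.
\<close>

definition Fp_space :: "nat \<Rightarrow> (int, nat \<Rightarrow> int) module"
  where "Fp_space p = ring.func_space (residue_ring (int p)) {..<p}"

lemma vectorspace_Fp_space:
  assumes "prime p"
  shows "vectorspace (residue_ring (int p)) (Fp_space p)"
proof -
  interpret residues_prime p "residue_ring (int p)"
    using assms by unfold_locales auto
  have "module (residue_ring (int p)) (Fp_space p)"
    unfolding Fp_space_def by (rule func_space_is_module)
  then show ?thesis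
    using is_field by (simp add: vectorspace_def)
qed

lemma carrier_Fp_space:
  assumes "prime p"
  shows "carrier (Fp_space p) = {..<p} \<rightarrow>\<^sub>E {0..int p - 1}"
proof -
  interpret residues_prime p "residue_ring (int p)"
    using assms by unfold_locales auto
  show ?thesis
    by (simp add: Fp_space_def func_space_def res_carrier_eq)
qed

end

theory Submission
  imports Defs
begin

text \<open>
  The idea is that modulo \<open>p\<close> and near \<open>u = 1\<close> the series \<open>F(u)\<close> is a combination of powers of \<open>u\<close>
  with pentagonal exponents only. Let \<open>X\<close> be the variable of the power series. For \<open>M = p\<^sup>k\<close> with
  \<open>k > 0\<close> and every power series \<open>u\<close> with constant coefficient 1, theorem \<open>strange_congruence\<close> shows
  \[ 2 F(u) \equiv - \sum_{n<M} (-1)^n (6n+1) u^{n(3n+1)/2} \pmod{(p, X^M)}, \]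
  a finite analogue of Zagier's strange identity.

  It comes from Zagier's two-variable series, with \<open>q = u\<close>,
  \[ S(x) = \sum_n (x;q)_{n+1} x^n, \quad S(x) = 1 - q x^2 - q^2 x^3 S(qx). \]
  Here \<open>F(q)\<close> is \<open>-S'(1)\<close>, so \<open>x\<close> is taken to be \<open>1 + \<epsilon>\<close> with \<open>\<epsilon>\<^sup>2 = 0\<close>. By the Frobenius
  map \<open>q\<^sup>M\<close> is 1 modulo \<open>(p, X\<^sup>M)\<close>. After \<open>M\<close> applications of the functional equation the argument
  \<open>q\<^sup>M x\<close> is therefore \<open>x\<close> again, and the equation becomes \<open>S(x) = P(x) - S(x)\<close> with an explicit finite
  sum \<open>P\<close>, all of whose powers of \<open>q\<close> have pentagonal exponents.

  For \<open>u = (1 - X)\<^sup>r\<close> the powers of \<open>u\<close> that occur are \<open>(1 - X)\<^sup>e\<close> with \<open>e = r n(3n+1)/2\<close>. Modulo \<open>p\<close>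
  the ring of power series is free over the series in \<open>X\<^sup>p\<close>, with basis \<open>(1 - X)\<^sup>m\<close> for \<open>m < p\<close>, and
  \<open>(1 - X)\<^sup>e\<close> only has a component at the \<open>m\<close> with \<open>m \<equiv> e\<close>. The component at \<open>m\<close> is read off
  by the vector of binomial coefficients \<open>j choose m\<close>, \<open>j < p\<close>. Hence this vector gives a congruence unless
  \<open>m \<equiv> r n(3n+1)/2\<close> for some \<open>n\<close> whose coefficient \<open>6n+1\<close> is a unit. As
  \<open>24 n(3n+1)/2 = (6n+1)\<^sup>2 - 1\<close>, the excluded \<open>m\<close> correspond to nonzero squares modulo \<open>p\<close>; there
  are at most \<open>(p-1)/2\<close> of them, and at least \<open>(p+1)/2\<close> indices \<open>m\<close> remain. The vectors are linearly
  independent because the matrix of binomial coefficients is unitriangular.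
\<close>

section \<open>Pentagonal exponents\<close>

definition pentagonal :: "nat \<Rightarrow> nat"
  where "pentagonal n = n * (3 * n + 1) div 2"

lemma two_pentagonal: "2 * pentagonal n = n * (3 * n + 1)"
  unfolding pentagonal_def by (cases "even n") simp_all

lemma pentagonal_0 [simp]: "pentagonal 0 = 0"
  by (simp add: pentagonal_def)

lemma pentagonal_Suc: "pentagonal (Suc n) = pentagonal n + 3 * n + 2"
proof -
  have "2 * pentagonal (Suc n) = 2 * (pentagonal n + 3 * n + 2)"
    unfolding distrib_left two_pentagonal by (simp add: algebra_simps)
  then show ?thesis by simp
qed

text \<open>
  Completing the square turns pentagonal exponents modulo \<open>p\<close> into squares.
\<close>

lemma pentagonal_square: "24 * int (pentagonal n) + 1 = (6 * int n + 1)\<^sup>2"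
proof -
  have "24 * int (pentagonal n) = 12 * int (2 * pentagonal n)" by simp
  also have "\<dots> = 12 * (int n * (3 * int n + 1))"
    by (simp only: two_pentagonal) (simp add: algebra_simps)
  finally show ?thesis by (simp add: power2_eq_square algebra_simps)
qed

section \<open>Congruence modulo an ideal of a type-class ring\<close>

text \<open>
  The ideals \<open>(p, X\<^sup>M)\<close> and \<open>(p, X\<^sup>M, \<epsilon>\<^sup>2)\<close> used below are not principal, so congruence modulo them
  is not divisibility by one element; the calculus of congruences is developed once for both.
\<close>

locale ring_ideal =
  fixes I :: "'a::comm_ring_1 set"
  assumes zero_mem: "0 \<in> I"
    and add_mem: "a \<in> I \<Longrightarrow> b \<in> I \<Longrightarrow> a + b \<in> I"
    and mult_mem: "a \<in> I \<Longrightarrow> c * a \<in> I"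
begin

definition eqv :: "'a \<Rightarrow> 'a \<Rightarrow> bool" (infix "\<approx>" 50)
  where "a \<approx> b \<longleftrightarrow> a - b \<in> I"

lemma uminus_mem: "a \<in> I \<Longrightarrow> - a \<in> I"
  using mult_mem [of a "- 1"] by simp

lemma mult_mem_right: "a \<in> I \<Longrightarrow> a * c \<in> I"
  using mult_mem [of a c] by (simp add: mult.commute)

lemma eqv_refl: "a \<approx> a"
  by (simp add: eqv_def zero_mem)

lemma eqv_sym: "a \<approx> b \<Longrightarrow> b \<approx> a"
  unfolding eqv_def using uminus_mem by fastforce

lemma eqv_trans [trans]: "a \<approx> b \<Longrightarrow> b \<approx> c \<Longrightarrow> a \<approx> c"
  unfolding eqv_def using add_mem [of "a - b" "b - c"] by simp

lemma eq_eqv_trans: "a = b \<Longrightarrow> b \<approx> c \<Longrightarrow> a \<approx> c"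
  by simp

lemma eqv_add: "a \<approx> b \<Longrightarrow> c \<approx> d \<Longrightarrow> a + c \<approx> b + d"
  unfolding eqv_def using add_mem [of "a - b" "c - d"] by (simp add: algebra_simps)

lemma eqv_uminus: "a \<approx> b \<Longrightarrow> - a \<approx> - b"
  unfolding eqv_def using uminus_mem [of "a - b"] by (simp add: algebra_simps)

lemma eqv_diff: "a \<approx> b \<Longrightarrow> c \<approx> d \<Longrightarrow> a - c \<approx> b - d"
  using eqv_add [of a b "- c" "- d"] eqv_uminus by simp

lemma eqv_mult: "a \<approx> b \<Longrightarrow> c \<approx> d \<Longrightarrow> a * c \<approx> b * d"
  unfolding eqv_def
  using add_mem [OF mult_mem [of "a - b" c] mult_mem [of "c - d" b]] by (simp add: algebra_simps)

lemma eqv_power: "a \<approx> b \<Longrightarrow> a ^ n \<approx> b ^ n"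
  by (induction n) (auto intro: eqv_mult eqv_refl)

lemma eqv_sum: "(\<And>i. i \<in> A \<Longrightarrow> f i \<approx> g i) \<Longrightarrow> sum f A \<approx> sum g A"
  by (induction A rule: infinite_finite_induct) (auto intro: eqv_add eqv_refl)

lemma eqv_prod: "(\<And>i. i \<in> A \<Longrightarrow> f i \<approx> g i) \<Longrightarrow> prod f A \<approx> prod g A"
  by (induction A rule: infinite_finite_induct) (auto intro: eqv_mult eqv_refl)

lemma eqv_power_cong:
  assumes "q ^ M \<approx> 1" "[a = b] (mod M)"
  shows "q ^ a \<approx> q ^ b"
proof -
  have *: "q ^ c \<approx> q ^ (c mod M)" for c
  proof -
    have "q ^ c = (q ^ M) ^ (c div M) * q ^ (c mod M)"
      by (simp flip: power_mult power_add)
    also have "\<dots> \<approx> 1 ^ (c div M) * q ^ (c mod M)"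
      by (intro eqv_mult eqv_power assms eqv_refl)
    finally show ?thesis by simp
  qed
  show ?thesis
    using assms(2) unfolding cong_def by (metis * eqv_sym eqv_trans)
qed

end

section \<open>The functional equation of Zagier's series\<close>

definition qpochhammer :: "'a::comm_ring_1 \<Rightarrow> 'a \<Rightarrow> nat \<Rightarrow> 'a"
  where "qpochhammer x q n = (\<Prod>j<n. 1 - x * q ^ j)"

text \<open>
  This is the partial sum of \<open>S(x)\<close> with \<open>N\<close> terms. Partial sums make sense in every commutative ring, and the
  remainder in the functional equation is killed later by a suitable ideal.
\<close>

definition zagier_sum :: "nat \<Rightarrow> 'a::comm_ring_1 \<Rightarrow> 'a \<Rightarrow> 'a"
  where "zagier_sum N q x = (\<Sum>n<N. qpochhammer x q (Suc n) * x ^ n)"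

lemma qpochhammer_Suc: "qpochhammer x q (Suc n) = qpochhammer x q n * (1 - x * q ^ n)"
  by (simp add: qpochhammer_def)

lemma qpochhammer_Suc_shift: "qpochhammer x q (Suc n) = (1 - x) * qpochhammer (x * q) q n"
  unfolding qpochhammer_def by (subst prod.lessThan_Suc_shift) (simp add: mult_ac)

text \<open>
  Put \<open>T = \<Sum>\<^sub>n (xq)\<^sub>n x\<^sup>n\<close> and \<open>U = \<Sum>\<^sub>n (xq)\<^sub>n (xq)\<^sup>n\<close>, where \<open>(a)\<^sub>n\<close> is \<open>qpochhammer a q n\<close>. Then
  \<open>S(x) = (1 - x) T\<close>. Expanding the last factor of \<open>(xq)\<^sub>n\<^sub>+\<^sub>1\<close> in \<open>T = 1 + \<Sum>\<^sub>n (xq)\<^sub>n\<^sub>+\<^sub>1 x\<^sup>n\<^sup>+\<^sup>1\<close> gives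
  \<open>(1 - x) T = 1 - q x\<^sup>2 U\<close>, and splitting off the first term gives \<open>U = 1 + x q S(xq)\<close>. The
  truncation at \<open>N\<close> adds the terms with \<open>(xq)\<^sub>N\<close>.
\<close>

lemma zagier_sum_functional_equation:
  "zagier_sum N q x = 1 - q * x\<^sup>2 - q\<^sup>2 * x ^ 3 * zagier_sum N q (x * q)
     + qpochhammer (x * q) q N * (q * x\<^sup>2 * (x * q) ^ N - x ^ N)"
proof -
  define T where "T = (\<Sum>n<N. qpochhammer (x * q) q n * x ^ n)"
  define U where "U = (\<Sum>n<N. qpochhammer (x * q) q n * (x * q) ^ n)"
  have S: "zagier_sum N q x = (1 - x) * T"
    by (simp add: zagier_sum_def T_def qpochhammer_Suc_shift sum_distrib_left mult_ac)
  have T: "(1 - x) * T + q * x\<^sup>2 * U + qpochhammer (x * q) q N * x ^ N = 1"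
    unfolding T_def U_def
  proof (induction N)
    case 0
    show ?case by (simp add: qpochhammer_def)
  next
    case (Suc N)
    then show ?case
      by (simp add: qpochhammer_Suc power2_eq_square power_mult_distrib algebra_simps)
  qed
  have U: "U + qpochhammer (x * q) q N * (x * q) ^ N = 1 + x * q * zagier_sum N q (x * q)"
    unfolding U_def zagier_sum_def
  proof (induction N)
    case 0
    show ?case by (simp add: qpochhammer_def)
  next
    case (Suc N)
    then show ?case
      by (simp add: algebra_simps)
  qed
  have "zagier_sum N q x = 1 - q * x\<^sup>2 * U - qpochhammer (x * q) q N * x ^ N"
  proof -
    have "a = 1 - b - c" if "a + b + c = 1" for a b c :: 'a
      unfolding that [symmetric] by (simp add: algebra_simps)
    then show ?thesis
      using T unfolding S .
  qed
  also have "U = 1 + x * q * zagier_sum N q (x * q) - qpochhammer (x * q) q N * (x * q) ^ N"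
    using U by (simp add: algebra_simps)
  finally show ?thesis
    by (simp add: power2_eq_square power3_eq_cube algebra_simps)
qed

text \<open>
  Applying the functional equation to \<open>x\<close>, \<open>xq\<close>, \<open>xq\<^sup>2\<close>, \<open>\<dots>\<close> accumulates the weight
  \<open>(-1)\<^sup>n x\<^sup>3\<^sup>n q\<^sup>e\<close>, where \<open>e\<close> is the sum of \<open>3 i + 2\<close> for \<open>i < n\<close>, which is \<open>n(3n+1)/2\<close>.
\<close>

lemma zagier_sum_iterate:
  "zagier_sum N q x = (\<Sum>n<K. (- 1) ^ n * x ^ (3 * n) * q ^ pentagonal n *
        (1 - q ^ (2 * n + 1) * x\<^sup>2
         + qpochhammer (x * q ^ Suc n) q N * (q ^ (2 * n + 1) * x\<^sup>2 * (x * q ^ Suc n) ^ N - (x * q ^ n) ^ N)))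
     + (- 1) ^ K * x ^ (3 * K) * q ^ pentagonal K * zagier_sum N q (x * q ^ K)"
proof (induction K)
  case 0
  show ?case by simp
next
  case (Suc K)
  define R where "R = qpochhammer (x * q ^ Suc K) q N
      * (q ^ (2 * K + 1) * x\<^sup>2 * (x * q ^ Suc K) ^ N - (x * q ^ K) ^ N)"
  have e: "q ^ (2 * K + 1) = q * (q ^ K)\<^sup>2"
    by (simp add: power_mult [symmetric] mult.commute)
  have "zagier_sum N q (x * q ^ K) = 1 - q ^ (2 * K + 1) * x\<^sup>2 + R
      - q\<^sup>2 * (x * q ^ K) ^ 3 * zagier_sum N q (x * q ^ Suc K)"
    unfolding R_def e
    by (subst zagier_sum_functional_equation) (simp add: power_mult_distrib mult_ac)
  moreover have "(- 1) ^ K * x ^ (3 * K) * q ^ pentagonal K * (q\<^sup>2 * (x * q ^ K) ^ 3)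
      = - ((- 1) ^ Suc K * x ^ (3 * Suc K) * q ^ pentagonal (Suc K))"
    by (simp add: pentagonal_Suc power_add power_mult_distrib power2_eq_square mult_ac
        flip: power_mult)
  ultimately have "(- 1) ^ K * x ^ (3 * K) * q ^ pentagonal K * zagier_sum N q (x * q ^ K)
      = (- 1) ^ K * x ^ (3 * K) * q ^ pentagonal K * (1 - q ^ (2 * K + 1) * x\<^sup>2 + R)
       + (- 1) ^ Suc K * x ^ (3 * Suc K) * q ^ pentagonal (Suc K) * zagier_sum N q (x * q ^ Suc K)"
    by (simp only: right_diff_distrib mult.assoc [symmetric]) simp
  with Suc show ?case
    unfolding R_def by (simp only: sum.lessThan_Suc add.assoc)
qed

context ring_ideal
begin

text \<open>
  If \<open>q\<^sup>M\<close> is 1 modulo the ideal, then each block of \<open>M\<close> consecutive factors contains one factor congruent to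
  \<open>1 - x\<close>. Two blocks give \<open>(1 - x)\<^sup>2\<close>, which is why the partial sums are taken up to \<open>2 M\<close>.
\<close>

lemma qpochhammer_mem:
  assumes "q ^ M \<approx> 1" "(1 - x)\<^sup>2 \<in> I" "n < M"
  shows "qpochhammer (x * q ^ Suc n) q (2 * M) \<in> I"
proof -
  let ?f = "\<lambda>j. 1 - x * q ^ Suc n * q ^ j"
  define i j where "i = M - Suc n" and "j = 2 * M - Suc n"
  have ij: "i < 2 * M" "j < 2 * M" "i \<noteq> j" "Suc n + i = M" "Suc n + j = 2 * M"
    using assms(3) by (auto simp: i_def j_def)
  have f: "?f k \<approx> 1 - x" if "[Suc n + k = 0] (mod M)" for k
  proof -
    have "?f k = 1 - x * q ^ (Suc n + k)"
      by (simp add: power_add mult_ac)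
    also have "\<dots> \<approx> 1 - x * q ^ 0"
      by (intro eqv_diff eqv_mult eqv_refl eqv_power_cong [OF assms(1) that])
    finally show ?thesis by simp
  qed
  have "?f i * ?f j \<approx> (1 - x) * (1 - x)"
    by (intro eqv_mult f) (simp_all only: ij, simp_all add: cong_def)
  then have "?f i * ?f j - (1 - x)\<^sup>2 + (1 - x)\<^sup>2 \<in> I"
    using assms(2) by (intro add_mem) (simp_all add: eqv_def power2_eq_square)
  then have m: "?f i * ?f j \<in> I" by simp
  have "qpochhammer (x * q ^ Suc n) q (2 * M) = ?f i * (?f j * prod ?f ({..<2 * M} - {i} - {j}))"
    unfolding qpochhammer_def using ij
    by (subst prod.remove [of _ i], simp, simp, subst prod.remove [of _ j]) auto
  also have "\<dots> = prod ?f ({..<2 * M} - {i} - {j}) * (?f i * ?f j)"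
    by (simp only: mult_ac)
  finally show ?thesis
    using mult_mem [OF m] by simp
qed

text \<open>
  The periodicity \<open>q\<^sup>M \<approx> 1\<close> closes the iteration: the weight after \<open>M\<close> steps is congruent to \<open>-1\<close> because
  \<open>M\<close> is odd and divides \<open>M(3M+1)/2\<close>, and so \<open>S(x) \<approx> P(x) - S(x)\<close>.
\<close>

theorem zagier_sum_eqv:
  assumes "odd M" "q ^ M \<approx> 1" "(1 - x)\<^sup>2 \<in> I" "x ^ M \<approx> 1"
  shows "2 * zagier_sum (2 * M) q x
     \<approx> (\<Sum>n<M. (- 1) ^ n * x ^ (3 * n) * q ^ pentagonal n * (1 - q ^ (2 * n + 1) * x\<^sup>2))"
    (is "_ \<approx> ?P")
proof -
  define w where "w n = (- 1) ^ n * x ^ (3 * n) * q ^ pentagonal n" for n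
  define R where "R n = qpochhammer (x * q ^ Suc n) q (2 * M)
     * (q ^ (2 * n + 1) * x\<^sup>2 * (x * q ^ Suc n) ^ (2 * M) - (x * q ^ n) ^ (2 * M))" for n
  let ?S = "zagier_sum (2 * M) q"
  have R: "R n \<approx> 0" if "n < M" for n
    unfolding R_def eqv_def diff_0_right
    by (rule mult_mem_right [OF qpochhammer_mem [OF assms(2,3) that]])
  have shift: "?S (x * q ^ M) \<approx> ?S x"
  proof -
    have "x * q ^ M \<approx> x"
      using eqv_mult [OF eqv_refl assms(2), of x] by simp
    then show ?thesis
      unfolding zagier_sum_def qpochhammer_def
      by (intro eqv_sum eqv_mult eqv_prod eqv_diff eqv_refl eqv_power)
  qed
  \<comment> \<open>The weight of the last term is \<open>-1\<close> modulo the ideal.\<close>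
  obtain k where k: "3 * M + 1 = 2 * k"
    using assms(1) by (metis even_plus_one_iff even_mult_iff evenE odd_numeral)
  have "pentagonal M = M * k"
    using two_pentagonal [of M] unfolding k by simp
  then have "[pentagonal M = 0] (mod M)"
    by (simp add: cong_0_iff)
  then have "w M \<approx> (- 1) ^ M * 1 * q ^ 0"
    unfolding w_def using eqv_power [OF assms(4), of 3] 
    by (intro eqv_mult eqv_refl eqv_power_cong [OF assms(2)]) (simp_all add: power_mult [symmetric] mult.commute)
  then have w: "w M \<approx> - 1"
    using assms(1) by simp
  have "?S x = (\<Sum>n<M. w n * (1 - q ^ (2 * n + 1) * x\<^sup>2 + R n)) + w M * ?S (x * q ^ M)"
    unfolding w_def R_def by (rule zagier_sum_iterate)
  also have "\<dots> \<approx> (\<Sum>n<M. w n * (1 - q ^ (2 * n + 1) * x\<^sup>2 + 0)) + (- 1) * ?S x"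
    by (intro eqv_add eqv_sum eqv_mult eqv_refl R shift w) auto
  also have "\<dots> = ?P - ?S x"
    by (simp add: w_def)
  finally have "?S x + ?S x \<approx> ?P - ?S x + ?S x"
    by (intro eqv_add eqv_refl)
  then show ?thesis
    by (simp only: mult_2 [of "?S x"] diff_add_cancel)
qed

end

section \<open>The ideal \<open>(p, X\<^sup>M)\<close> and the Frobenius map\<close>

definition fps_ideal :: "nat \<Rightarrow> nat \<Rightarrow> int fps set"
  where "fps_ideal p M = {f. \<forall>k<M. int p dvd fps_nth f k}"

lemma fps_ideal_mult:
  assumes "f \<in> fps_ideal p a" "g \<in> fps_ideal p b"
  shows "f * g \<in> fps_ideal p (a + b)"
proof -
  have "int p dvd fps_nth (f * g) k" if "k < a + b" for k
    unfolding fps_mult_nth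
  proof (rule dvd_sum)
    fix i assume "i \<in> {0..k}"
    then have "i < a \<or> k - i < b" using that by auto
    then show "int p dvd fps_nth f i * fps_nth g (k - i)"
      using assms by (auto simp: fps_ideal_def)
  qed
  then show ?thesis by (simp add: fps_ideal_def)
qed

interpretation fps_ideal: ring_ideal "fps_ideal p M" for p M
proof
  show "0 \<in> fps_ideal p M" by (simp add: fps_ideal_def)
  show "a + b \<in> fps_ideal p M" if "a \<in> fps_ideal p M" "b \<in> fps_ideal p M" for a b
    using that by (simp add: fps_ideal_def)
  show "c * a \<in> fps_ideal p M" if "a \<in> fps_ideal p M" for a c
    using fps_ideal_mult [of c p 0 a M] that by (simp add: fps_ideal_def)
qed

lemma fps_ideal_eqv_iff:
  "fps_ideal.eqv p M f g \<longleftrightarrow> (\<forall>k<M. [fps_nth f k = fps_nth g k] (mod int p))"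
  by (simp add: fps_ideal.eqv_def) (simp add: fps_ideal_def cong_iff_dvd_diff)

lemma fps_ideal_power: "f \<in> fps_ideal p a \<Longrightarrow> f ^ n \<in> fps_ideal p (n * a)"
  by (induction n) (auto simp: fps_ideal_mult, simp add: fps_ideal_def)

lemma of_nat_mem_fps_ideal: "p dvd n \<Longrightarrow> of_nat n \<in> fps_ideal p M"
  by (auto simp: fps_ideal_def fps_of_nat [symmetric])

text \<open>
  If \<open>u\<^bsup>p\<^sup>k\<^esup> = 1 + w\<close>, then in \<open>(1 + w)\<^sup>p\<close> the middle binomial coefficients are divisible by \<open>p\<close>, and
  modulo \<open>p\<close> the power \<open>w\<^sup>p\<close> vanishes to \<open>p\<close> times the order of \<open>w\<close>.
\<close>

lemma frobenius_eqv_1: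
  assumes "prime p" "fps_nth u 0 = 1"
  shows "fps_ideal.eqv p (p ^ k) (u ^ (p ^ k)) 1"
proof (induction k)
  case 0
  show ?case using assms(2) by (simp add: fps_ideal_eqv_iff)
next
  case (Suc k)
  define w where "w = u ^ (p ^ k) - 1"
  have w: "w \<in> fps_ideal p (p ^ k)"
    using Suc by (simp add: fps_ideal.eqv_def w_def)
  have p: "p > 0" using assms(1) by (simp add: prime_gt_0_nat)
  have "u ^ (p ^ Suc k) = (w + 1) ^ p"
    by (simp add: w_def power_mult mult.commute [of p])
  also have "\<dots> = (\<Sum>i\<le>p. of_nat (p choose i) * w ^ i)"
    by (simp add: binomial_ring)
  also have "\<dots> = of_nat (p choose 0) * w ^ 0 + (\<Sum>i\<in>{..p} - {0}. of_nat (p choose i) * w ^ i)"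
    by (subst sum.remove [of _ 0]) auto
  finally have "u ^ (p ^ Suc k) - 1 = (\<Sum>i\<in>{..p} - {0}. of_nat (p choose i) * w ^ i)"
    by simp
  also have "fps_ideal.eqv p (p ^ Suc k) \<dots> (\<Sum>i\<in>{..p} - {0}. 0)"
  proof (rule fps_ideal.eqv_sum)
    fix i assume i: "i \<in> {..p} - {0}"
    show "fps_ideal.eqv p (p ^ Suc k) (of_nat (p choose i) * w ^ i) 0"
    proof (cases "i = p")
      case True
      then show ?thesis
        using fps_ideal_power [OF w, of p] by (simp add: fps_ideal.eqv_def)
    next
      case False
      then have "p dvd (p choose i)"
        using i p by (intro dvd_choose_prime assms(1)) auto
      then show ?thesis
        using fps_ideal.mult_mem [OF of_nat_mem_fps_ideal [of p "p choose i" "p ^ Suc k"], of "w ^ i"]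
        by (simp add: fps_ideal.eqv_def mult.commute)
    qed
  qed
  finally show ?case
    by (simp add: fps_ideal.eqv_def)
qed

section \<open>Dual numbers and the strange congruence\<close>

text \<open>
  In \<open>int fps fps\<close> the outer variable plays the role of \<open>\<epsilon>\<close>, and modulo this ideal only the dual number
  \<open>f(0) + \<epsilon> f'(0)\<close> over \<open>\<int>[[X]] / (p, X\<^sup>M)\<close> is remembered.
\<close>

definition dual_ideal :: "nat \<Rightarrow> nat \<Rightarrow> int fps fps set"
  where "dual_ideal p M = {f. fps_nth f 0 \<in> fps_ideal p M \<and> fps_nth f 1 \<in> fps_ideal p M}"

interpretation dual_ideal: ring_ideal "dual_ideal p M" for p M
proof
  show "0 \<in> dual_ideal p M" by (simp add: dual_ideal_def fps_ideal.zero_mem)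
  show "a + b \<in> dual_ideal p M" if "a \<in> dual_ideal p M" "b \<in> dual_ideal p M" for a b
    using that by (simp add: dual_ideal_def fps_ideal.add_mem)
  show "c * a \<in> dual_ideal p M" if "a \<in> dual_ideal p M" for a c
    using that by (simp add: dual_ideal_def fps_mult_nth_1 fps_ideal.add_mem fps_ideal.mult_mem)
qed

lemma dual_ideal_eqv_iff:
  "dual_ideal.eqv p M f g \<longleftrightarrow>
     fps_ideal.eqv p M (fps_nth f 0) (fps_nth g 0) \<and> fps_ideal.eqv p M (fps_nth f 1) (fps_nth g 1)"
  by (simp add: dual_ideal.eqv_def fps_ideal.eqv_def) (simp add: dual_ideal_def)

lemma one_plus_X_power_nth:
  "fps_nth ((1 + fps_X :: 'a::comm_ring_1 fps) ^ m) 0 = 1"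
  "fps_nth ((1 + fps_X :: 'a::comm_ring_1 fps) ^ m) (Suc 0) = of_nat m"
  by (induction m) (simp_all add: fps_power_zeroth fps_mult_nth_1 algebra_simps)

text \<open>
  The factor \<open>1 - x = -\<epsilon>\<close> of \<open>(x;q)\<^sub>n\<^sub>+\<^sub>1\<close> leaves the rest of the product to be evaluated at \<open>\<epsilon> = 0\<close>,
  where it is \<open>(u;u)\<^sub>n\<close>.
\<close>

lemma zagier_sum_dual_nth_1:
  "fps_nth (zagier_sum N (fps_const u) (1 + fps_X :: 'a::comm_ring_1 fps fps)) 1 = - (\<Sum>n<N. qpoch u n)"
proof -
  let ?x = "1 + fps_X :: 'a fps fps" and ?q = "fps_const u"
  have "fps_nth (qpochhammer ?x ?q (Suc n) * ?x ^ n) 1 = - qpoch u n" for n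
  proof -
    have "fps_nth (qpochhammer ?x ?q (Suc n) * ?x ^ n) 1
        = fps_nth (- fps_X * (qpochhammer (?x * ?q) ?q n * ?x ^ n)) 1"
      by (simp add: qpochhammer_Suc_shift mult.assoc)
    also have "\<dots> = - fps_nth (qpochhammer (?x * ?q) ?q n) 0"
      by (simp add: fps_power_zeroth)
    also have "fps_nth (qpochhammer (?x * ?q) ?q n) 0 = (\<Prod>j<n. 1 - u ^ Suc j)"
      by (induction n) (simp_all add: qpochhammer_def fps_power_zeroth)
    also have "\<dots> = qpoch u n"
      unfolding qpoch_def by (rule prod.reindex_bij_witness [of _ "\<lambda>i. i - 1" Suc]) auto
    finally show ?thesis .
  qed
  then show ?thesis
    by (simp add: zagier_sum_def fps_sum_nth sum_negf)
qed

text \<open>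
  The exponents \<open>n(3n+1)/2\<close> and \<open>n(3n+1)/2 + 2n + 1\<close> are the two families of generalized pentagonal
  numbers, for \<open>n\<close> and \<open>-n-1\<close>; modulo \<open>M\<close> the latter index is the same as \<open>M - 1 - n\<close>.
\<close>

lemma pentagonal_reflect:
  assumes "odd M" "n < M"
  shows "[pentagonal (M - Suc n) + (2 * (M - Suc n) + 1) = pentagonal n] (mod M)"
proof -
  define l where "l = M - Suc n"
  have M: "M = n + l + 1" using assms(2) by (simp add: l_def)
  have "2 * int (pentagonal l + (2 * l + 1)) - 2 * int (pentagonal n)
      = int (l * (3 * l + 1)) + 4 * int l + 2 - int (n * (3 * n + 1))"
    unfolding two_pentagonal [symmetric] by simp
  also have "\<dots> = int M * (3 * int l - 3 * int n + 2)"
    by (simp add: M algebra_simps)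
  finally have "int M dvd 2 * (int (pentagonal l + (2 * l + 1)) - int (pentagonal n))"
    by (simp add: right_diff_distrib)
  moreover have "coprime (int M) 2"
    using assms(1) by simp
  ultimately have "int M dvd int (pentagonal l + (2 * l + 1)) - int (pentagonal n)"
    by (rule coprime_dvd_mult_right_iff [THEN iffD1, rotated])
  then have "[int (pentagonal l + (2 * l + 1)) = int (pentagonal n)] (mod int M)"
    by (simp add: cong_iff_dvd_diff)
  then show ?thesis
    unfolding cong_int_iff l_def .
qed

text \<open>
  The \<open>\<epsilon>\<close>-coefficient of \<open>zagier_sum_eqv\<close> at \<open>x = 1 + \<epsilon>\<close> reads
  \<open>-2 F(u) \<approx> \<Sum> (-1)\<^sup>n (3n u\<^sup>e - (3n+2) u\<^sup>f)\<close> with \<open>e = n(3n+1)/2\<close> and \<open>f = e + 2n + 1\<close>. The reflection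
  \<open>n \<mapsto> M - 1 - n\<close> carries the terms of the second kind to \<open>(-1)\<^sup>n (3n+1) u\<^sup>e\<close>. The resulting factor
  \<open>6n+1\<close> is essential: its zeros modulo \<open>p\<close> remove one further residue class of exponents.
\<close>

theorem strange_congruence:
  fixes u :: "int fps"
  assumes "prime p" "odd p" "fps_nth u 0 = 1" "k > 0"
  defines "M \<equiv> p ^ k"
  shows "fps_ideal.eqv p M (2 * fishburn_F u)
     (- (\<Sum>n<M. (- 1) ^ n * of_int (6 * int n + 1) * u ^ pentagonal n))"
proof -
  let ?x = "1 + fps_X :: int fps fps" and ?q = "fps_const u"
  note uM = frobenius_eqv_1 [OF assms(1,3), of k, folded M_def]
  have oM: "odd M" and pM: "p dvd M" using assms by (auto simp: M_def)
  have "dual_ideal.eqv p M (2 * zagier_sum (2 * M) ?q ?x)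
    (\<Sum>n<M. (- 1) ^ n * ?x ^ (3 * n) * ?q ^ pentagonal n * (1 - ?q ^ (2 * n + 1) * ?x\<^sup>2))"
  proof (rule dual_ideal.zagier_sum_eqv [OF oM])
    show "dual_ideal.eqv p M (?q ^ M) 1"
      using uM by (simp add: dual_ideal_eqv_iff fps_ideal.eqv_refl)
    show "(1 - ?x)\<^sup>2 \<in> dual_ideal p M"
      by (simp add: dual_ideal_def power2_eq_square fps_ideal.zero_mem fps_mult_nth_1)
    show "dual_ideal.eqv p M (?x ^ M) 1"
      using of_nat_mem_fps_ideal [OF pM]
      by (simp add: dual_ideal_eqv_iff fps_ideal.eqv_refl one_plus_X_power_nth)
        (simp add: fps_ideal.eqv_def)
  qed
  then have 1: "fps_ideal.eqv p M (fps_nth (2 * zagier_sum (2 * M) ?q ?x) 1)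
    (fps_nth (\<Sum>n<M. (- 1) ^ n * ?x ^ (3 * n) * ?q ^ pentagonal n * (1 - ?q ^ (2 * n + 1) * ?x\<^sup>2)) 1)"
    unfolding dual_ideal_eqv_iff by blast
  have lhs: "fps_nth (2 * zagier_sum (2 * M) ?q ?x) 1 = - 2 * (\<Sum>n<2 * M. qpoch u n)"
  proof -
    have "fps_nth (2 * f) 1 = 2 * fps_nth f 1" for f :: "int fps fps"
      by (simp only: mult_2 fps_add_nth)
    then show ?thesis by (simp only: zagier_sum_dual_nth_1) simp
  qed
  have coeff: "fps_nth ((- 1) ^ n * ?x ^ (3 * n) * ?q ^ pentagonal n * (1 - ?q ^ (2 * n + 1) * ?x\<^sup>2)) 1
     = (- 1) ^ n * of_nat (3 * n) * u ^ pentagonal n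
       - (- 1) ^ n * of_nat (3 * n + 2) * u ^ (pentagonal n + (2 * n + 1))" for n
  proof -
    have "(- 1) ^ n * ?x ^ (3 * n) * ?q ^ pentagonal n * (1 - ?q ^ (2 * n + 1) * ?x\<^sup>2)
      = fps_const ((- 1) ^ n * u ^ pentagonal n) * ?x ^ (3 * n)
       - fps_const ((- 1) ^ n * u ^ (pentagonal n + (2 * n + 1))) * ?x ^ (3 * n + 2)"
    proof -
      have c: "fps_const ((- 1) ^ n * u ^ k) = (- 1) ^ n * ?q ^ k" for k
        by (cases "even n") simp_all
      have ring: "s * y * a * (1 - b * z) = s * a * y - s * (a * b) * (y * z)"
        for s y a b z :: "int fps fps"
        by (simp add: algebra_simps)
      show ?thesis
        unfolding c power_add [of ?q "pentagonal n"] power_add [of ?x "3 * n"] by (rule ring)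
    qed
    then show ?thesis
      by (simp only: fps_sub_nth fps_mult_left_const_nth One_nat_def one_plus_X_power_nth)
        (simp only: mult_ac)
  qed
  let ?A = "\<lambda>n. (- 1) ^ n * of_nat (3 * n) * u ^ pentagonal n"
  let ?B = "\<lambda>n. (- 1) ^ n * of_nat (3 * n + 2) * u ^ (pentagonal n + (2 * n + 1))"
  have "fps_ideal.eqv p M (?B (M - Suc n)) (- ((- 1) ^ n * of_nat (3 * n + 1) * u ^ pentagonal n))"
    if "n < M" for n
  proof -
    let ?l = "M - Suc n"
    have M: "M = n + ?l + 1" using that by simp
    then have "even (n + ?l)" using oM by (metis even_add odd_one)
    then have s: "(- 1) ^ ?l = (- 1 :: int fps) ^ n" by (simp add: minus_one_power_iff)
    have "of_nat (3 * ?l + 2) + (of_nat (3 * n + 1) :: int fps) = of_nat (3 * M)"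
      by (subst M) (simp only: of_nat_add [symmetric], simp)
    then have "of_nat (3 * ?l + 2) - (- of_nat (3 * n + 1) :: int fps) \<in> fps_ideal p M"
      using of_nat_mem_fps_ideal [of p "3 * M"] pM by simp
    then have "fps_ideal.eqv p M ((- 1) ^ n * of_nat (3 * ?l + 2) * u ^ (pentagonal ?l + (2 * ?l + 1)))
       ((- 1) ^ n * (- of_nat (3 * n + 1)) * u ^ pentagonal n)"
      by (intro fps_ideal.eqv_mult fps_ideal.eqv_refl
          fps_ideal.eqv_power_cong [OF uM pentagonal_reflect [OF oM that]])
        (simp only: fps_ideal.eqv_def)
    then show ?thesis
      unfolding s by (simp only: mult_minus_right mult_minus_left)
  qed
  then have "fps_ideal.eqv p M (\<Sum>n<M. ?B (M - Suc n))
      (\<Sum>n<M. - ((- 1) ^ n * of_nat (3 * n + 1) * u ^ pentagonal n))"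
    by (intro fps_ideal.eqv_sum) (simp only: lessThan_iff)
  then have B: "fps_ideal.eqv p M (\<Sum>n<M. ?B n)
      (\<Sum>n<M. - ((- 1) ^ n * of_nat (3 * n + 1) * u ^ pentagonal n))"
    by (rule fps_ideal.eq_eqv_trans [OF sum.nat_diff_reindex [of ?B M, symmetric]])
  have "fps_ideal.eqv p M (- 2 * (\<Sum>n<2 * M. qpoch u n)) ((\<Sum>n<M. ?A n) - (\<Sum>n<M. ?B n))"
    using 1 unfolding lhs fps_sum_nth coeff sum_subtractf .
  also have "fps_ideal.eqv p M \<dots>
     ((\<Sum>n<M. ?A n) - (\<Sum>n<M. - ((- 1) ^ n * of_nat (3 * n + 1) * u ^ pentagonal n)))"
    by (intro fps_ideal.eqv_diff fps_ideal.eqv_refl B)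
  also have "\<dots> = (\<Sum>n<M. (- 1) ^ n * of_int (6 * int n + 1) * u ^ pentagonal n)"
    unfolding sum_subtractf [symmetric] by (intro sum.cong) (simp_all add: algebra_simps)
  finally have "fps_ideal.eqv p M (- 2 * (\<Sum>n<2 * M. qpoch u n))
      (\<Sum>n<M. (- 1) ^ n * of_int (6 * int n + 1) * u ^ pentagonal n)" .
  from fps_ideal.eqv_uminus [OF this] have 2: "fps_ideal.eqv p M (2 * (\<Sum>n<2 * M. qpoch u n))
      (- (\<Sum>n<M. (- 1) ^ n * of_int (6 * int n + 1) * u ^ pentagonal n))"
    by (simp only: mult_minus_left minus_minus)
  have "fps_nth (fishburn_F u) k = fps_nth (\<Sum>n<2 * M. qpoch u n) k" if "k < M" for k
    unfolding sums_fishburn_F(2) [OF assms(3)] fps_sum_nth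
    using that assms(3) by (intro sum.mono_neutral_left) (auto simp: fps_nth_qpoch_eq_0)
  then have "fps_ideal.eqv p M (fishburn_F u) (\<Sum>n<2 * M. qpoch u n)"
    by (simp add: fps_ideal_eqv_iff)
  then have "fps_ideal.eqv p M (2 * fishburn_F u) (2 * (\<Sum>n<2 * M. qpoch u n))"
    by (intro fps_ideal.eqv_mult fps_ideal.eqv_refl)
  then show ?thesis using 2 by (rule fps_ideal.eqv_trans)
qed

section \<open>Components of a power series modulo \<open>p\<close>\<close>

text \<open>
  Write \<open>f\<close> modulo \<open>p\<close> as \<open>\<Sum>\<^sub>m (1 - X)\<^sup>m g\<^sub>m(X\<^sup>p)\<close> with \<open>m < p\<close>. Since the coefficient of \<open>(1 - X)\<^sup>m\<close> in
  \<open>X\<^sup>j = (1 - (1 - X))\<^sup>j\<close> is \<open>(-1)\<^sup>m (j choose m)\<close>, the sum below is up to sign the \<open>n\<close>-th coefficient of \<open>g\<^sub>m\<close>,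
  and the predicate says that \<open>g\<^sub>m\<close> vanishes modulo \<open>p\<close>.
\<close>

definition lacks_residue :: "nat \<Rightarrow> nat \<Rightarrow> int fps \<Rightarrow> bool"
  where "lacks_residue p m f \<longleftrightarrow>
    (\<forall>n. [(\<Sum>j<p. int (j choose m) * fps_nth f (p * n + j)) = 0] (mod int p))"

lemma one_minus_X_power_nth:
  "fps_nth ((1 - fps_X :: 'a::comm_ring_1 fps) ^ m) k = (- 1) ^ k * of_nat (m choose k)"
proof -
  have "(1 - fps_X :: 'a fps) ^ m = (- fps_X + 1) ^ m" by simp
  also have "\<dots> = (\<Sum>i\<le>m. of_nat (m choose i) * (- fps_X) ^ i)"
    by (subst binomial_ring) simp
  also have "\<dots> = (\<Sum>i\<le>m. fps_const ((- 1) ^ i * of_nat (m choose i)) * fps_X ^ i)"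
    by (intro sum.cong refl) (simp add: power_minus [of fps_X] mult_ac fps_of_nat [symmetric]
      fps_const_power [symmetric] fps_const_neg [symmetric] fps_const_mult [symmetric]
      del: fps_const_power fps_const_mult fps_const_neg)
  finally have "fps_nth ((1 - fps_X :: 'a fps) ^ m) k
      = fps_nth (\<Sum>i\<le>m. fps_const ((- 1) ^ i * of_nat (m choose i)) * fps_X ^ i) k"
    by (rule arg_cong)
  also have "\<dots> = (\<Sum>i\<le>m. if k = i then (- 1) ^ i * of_nat (m choose i) else 0)"
    unfolding fps_sum_nth by (intro sum.cong refl) (simp add: fps_X_power_nth)
  finally show ?thesis
    by (simp add: binomial_eq_0)
qed

text \<open>
  The lower triangular matrices \<open>(j choose m)\<close> and \<open>((-1)\<^sup>j (a choose j))\<close> are inverse to each other up to signs,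
  by \<open>(a choose j)(j choose m) = (a choose m)((a-m) choose (j-m))\<close>.
\<close>

lemma alternating_sum_choose_mult:
  assumes "a \<noteq> m" "a < p"
  shows "(\<Sum>j<p. (j choose m) * ((- 1) ^ j * (a choose j)) :: int) = 0"
proof (cases "a < m")
  case True
  have "(j choose m) * (a choose j) = 0" for j
    using True by (cases "j < m") auto
  then show ?thesis by (intro sum.neutral) (metis mult.left_commute mult_zero_right of_nat_0 of_nat_mult)
next
  case False
  then have ma: "m < a" using assms by simp
  have "(\<Sum>j<p. (j choose m) * ((- 1) ^ j * (a choose j)) :: int)
      = (\<Sum>j\<in>{m..a}. (- 1) ^ j * int ((a choose j) * (j choose m)))"
    using assms(2) by (intro sum.mono_neutral_cong_right) auto
  also have "\<dots> = (\<Sum>j\<in>{m..a}. (- 1) ^ j * int ((a choose m) * ((a - m) choose (j - m))))"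
    by (intro sum.cong refl) (simp add: choose_mult)
  also have "\<dots> = (\<Sum>i\<le>a - m. (- 1) ^ (i + m) * int ((a choose m) * ((a - m) choose i)))"
    by (rule sum.reindex_bij_witness [of _ "\<lambda>i. i + m" "\<lambda>j. j - m"]) (use ma in auto)
  also have "\<dots> = (- 1) ^ m * int (a choose m) * (\<Sum>i\<le>a - m. (- 1) ^ i * int ((a - m) choose i))"
    by (simp add: sum_distrib_left power_add mult_ac)
  also have "(\<Sum>i\<le>a - m. (- 1) ^ i * int ((a - m) choose i)) = 0"
    using choose_alternating_sum [of "a - m", where 'a = int] ma by simp
  finally show ?thesis by simp
qed

lemma sum_window_mult_X_power:
  "(\<Sum>j<p. c j * fps_nth (f * fps_X ^ p) (p * n + j))
     = (if n = 0 then 0 else \<Sum>j<p. c j * fps_nth f (p * (n - 1) + j))"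
proof (cases n)
  case (Suc l)
  then show ?thesis
    by (auto simp: fps_X_power_mult_right_nth algebra_simps intro!: sum.cong)
qed (auto simp: fps_X_power_mult_right_nth intro!: sum.neutral)

lemma one_minus_X_power_prime:
  assumes "prime p" "odd p"
  shows "[fps_nth ((1 - fps_X :: int fps) ^ p) k = fps_nth (1 - fps_X ^ p) k] (mod int p)"
proof -
  have p: "p > 0" using assms(1) by (simp add: prime_gt_0_nat)
  consider "k = 0" | "k = p" | "k \<noteq> 0" "k < p" | "k > p" by linarith
  then show ?thesis
  proof cases
    case 3
    then have "p dvd (p choose k)"
      using p by (intro dvd_choose_prime assms(1)) auto
    then show ?thesis
      using 3 by (simp add: one_minus_X_power_nth fps_X_power_nth cong_0_iff)
  qed (use p assms(2) in \<open>auto simp: one_minus_X_power_nth fps_X_power_nth binomial_eq_0\<close>)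
qed

lemma cong_fps_mult:
  assumes "\<And>k. [fps_nth f k = fps_nth g k] (mod m)"
  shows "[fps_nth (h * f) k = fps_nth (h * g) k] (mod (m::int))"
  unfolding fps_mult_nth by (intro cong_sum cong_mult assms cong_refl)

text \<open>
  Modulo \<open>p\<close> the factor is \<open>1 - X\<^sup>p\<close>, a unit among the series in \<open>X\<^sup>p\<close>, so it preserves the vanishing of each
  component. The equivalence, rather than one implication, is what allows negative exponents of \<open>1 - X\<close>.
\<close>

lemma lacks_residue_mult_iff:
  assumes "prime p" "odd p"
  shows "lacks_residue p m (f * (1 - fps_X) ^ p) \<longleftrightarrow> lacks_residue p m f"
proof -
  define L where "L g n = (\<Sum>j<p. int (j choose m) * fps_nth g (p * n + j))" for g n
  have step: "[L (f * (1 - fps_X) ^ p) n = L f n - (if n = 0 then 0 else L f (n - 1))] (mod int p)"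
    for n
  proof -
    have "[L (f * (1 - fps_X) ^ p) n = L (f * (1 - fps_X ^ p)) n] (mod int p)"
      unfolding L_def
      by (intro cong_sum cong_mult cong_refl cong_fps_mult one_minus_X_power_prime assms)
    also have "L (f * (1 - fps_X ^ p)) n = L f n - L (f * fps_X ^ p) n"
      by (simp add: L_def right_diff_distrib sum_subtractf)
    also have "L (f * fps_X ^ p) n = (if n = 0 then 0 else L f (n - 1))"
      unfolding L_def by (rule sum_window_mult_X_power)
    finally show ?thesis .
  qed
  have ann: "lacks_residue p m g \<longleftrightarrow> (\<forall>n. int p dvd L g n)" for g
    by (simp add: lacks_residue_def L_def cong_0_iff)
  have step': "int p dvd L (f * (1 - fps_X) ^ p) n \<longleftrightarrow>
      int p dvd L f n - (if n = 0 then 0 else L f (n - 1))" for n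
    using cong_dvd_iff [OF step] by simp
  show ?thesis
  proof
    assume "lacks_residue p m f"
    then show "lacks_residue p m (f * (1 - fps_X) ^ p)"
      unfolding ann step' by auto
  next
    assume *: "lacks_residue p m (f * (1 - fps_X) ^ p)"
    have "int p dvd L f n" for n
    proof (induction n)
      case 0
      show ?case using * step' [of 0] by (simp add: ann)
    next
      case (Suc n)
      have "int p dvd L f (Suc n) - L f n"
        using * step' [of "Suc n"] by (simp add: ann)
      with Suc show ?case by (metis diff_add_cancel dvd_add)
    qed
    then show "lacks_residue p m f" by (simp add: ann)
  qed
qed

lemma one_minus_q_powi_of_nat: "one_minus_q_powi (int n) = (1 - fps_X) ^ n"
  by (simp add: one_minus_q_powi_def)

lemma lacks_residue_one_minus_q_powi:
  assumes "prime p" "odd p" "m < p" "\<not> [e = int m] (mod int p)"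
  shows "lacks_residue p m (one_minus_q_powi e)"
proof -
  have p: "p > 0" using assms(1) by (simp add: prime_gt_0_nat)
  define a where "a = nat (e mod int p)"
  have a: "int a = e mod int p" "a < p"
    using p by (simp_all add: a_def nat_less_iff)
  have am: "a \<noteq> m"
    using assms(4) a(1) by (auto simp: cong_def)
  have shift: "lacks_residue p m (one_minus_q_powi (i + int p)) = lacks_residue p m (one_minus_q_powi i)"
    for i
    unfolding one_minus_q_powi_add one_minus_q_powi_of_nat
    by (rule lacks_residue_mult_iff [OF assms(1,2)])
  have base: "lacks_residue p m (one_minus_q_powi (int a))"
    unfolding lacks_residue_def
  proof
    fix n
    \<comment> \<open>\<open>(1 - X)\<^sup>a\<close> has degree less than \<open>p\<close>, so only \<open>n = 0\<close> matters.\<close>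
    have "(\<Sum>j<p. int (j choose m) * fps_nth (one_minus_q_powi (int a)) (p * n + j)) = 0"
    proof (cases "n = 0")
      case True
      then show ?thesis
        using alternating_sum_choose_mult [OF am a(2)]
        by (simp add: one_minus_q_powi_of_nat one_minus_X_power_nth)
    next
      case False
      then have "a < p * n + j" for j
        using a(2) by (cases n) (auto simp: trans_less_add1)
      then have "fps_nth (one_minus_q_powi (int a)) (p * n + j) = 0" for j
        by (simp only: one_minus_q_powi_of_nat one_minus_X_power_nth binomial_eq_0
            of_nat_0 mult_zero_right)
      then show ?thesis by simp
    qed
    then show "[(\<Sum>j<p. int (j choose m) * fps_nth (one_minus_q_powi (int a)) (p * n + j)) = 0]
        (mod int p)"
      by simp
  qed
  have "lacks_residue p m (one_minus_q_powi (int a + i * int p))" for i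
  proof (induction i rule: int_induct [where k = 0])
    case base
    show ?case using \<open>lacks_residue p m (one_minus_q_powi (int a))\<close> by simp
  next
    case (step1 i)
    then show ?case using shift [of "int a + i * int p"] by (simp add: algebra_simps)
  next
    case (step2 i)
    then show ?case using shift [of "int a + (i - 1) * int p"] by (simp add: algebra_simps)
  qed
  from this [of "e div int p"] show ?thesis
    by (simp add: a(1))
qed

section \<open>Linear independence of the binomial vectors\<close>

definition binomial_vector :: "nat \<Rightarrow> nat \<Rightarrow> nat \<Rightarrow> int"
  where "binomial_vector p m = (\<lambda>j\<in>{..<p}. int (j choose m) mod int p)"

lemma lincomb_Fp_space:
  assumes "prime p" "finite A" "A \<subseteq> carrier (Fp_space p)" 
    "a \<in> A \<rightarrow> carrier (residue_ring (int p))" "j < p"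
  shows "module.lincomb (Fp_space p) a A j = (\<Sum>v\<in>A. a v * v j) mod int p"
proof -
  interpret residues_prime p "residue_ring (int p)"
    using assms(1) by unfold_locales auto
  interpret V: vectorspace "residue_ring (int p)" "Fp_space p"
    using assms(1) by (rule vectorspace_Fp_space)
  show ?thesis
    using assms(2-4)
  proof (induction A)
    case empty
    have "V.lincomb a {} = \<zero>\<^bsub>Fp_space p\<^esub>"
      unfolding V.lincomb_def by (rule V.finsum_empty)
    then show ?case
      using assms(5) by (simp add: Fp_space_def func_space_def res_zero_eq)
  next
    case (insert v A)
    have "V.lincomb a (insert v A) = a v \<odot>\<^bsub>Fp_space p\<^esub> v \<oplus>\<^bsub>Fp_space p\<^esub> V.lincomb a A"
      using V.lincomb_insert [of A a v] insert.prems insert.hyps by (simp add: Pi_iff)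
    then have "V.lincomb a (insert v A) j = (a v * v j mod int p + V.lincomb a A j) mod int p"
      using assms(5) by (simp add: Fp_space_def func_space_def res_add_eq res_mult_eq)
    also have "V.lincomb a A j = (\<Sum>v\<in>A. a v * v j) mod int p"
      using insert by (auto simp: Pi_iff)
    finally show ?case
      using insert.hyps by (simp add: mod_simps)
  qed
qed

lemma binomial_vector_diagonal:
  assumes "m < p"
  shows "binomial_vector p m m = 1 mod int p" and "\<And>j. j < m \<Longrightarrow> binomial_vector p m j = 0"
  using assms by (simp_all add: binomial_vector_def binomial_eq_0)

lemma inj_on_binomial_vector:
  assumes "p > 1"
  shows "inj_on (binomial_vector p) {..<p}"
proof (rule linorder_inj_onI)
  fix m m' assume "m < m'" "m \<in> {..<p}" "m' \<in> {..<p}"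
  then have "binomial_vector p m m = 1" "binomial_vector p m' m = 0"
    using assms binomial_vector_diagonal(1) [of m p] binomial_vector_diagonal(2) [of m' p m] by simp_all
  then show "binomial_vector p m \<noteq> binomial_vector p m'" by auto
qed auto

text \<open>
  The vectors are in echelon form: the entry of \<open>binomial_vector p m\<close> at \<open>m\<close> is 1, and the entries before it
  vanish. In a relation, the least \<open>m\<close> with a nonzero coefficient is contradicted at the entry \<open>m\<close>.
\<close>

lemma lin_indpt_binomial_vector:
  assumes "prime p" "G \<subseteq> {..<p}"
  shows "binomial_vector p ` G \<subseteq> carrier (Fp_space p)"
    and "\<not> module.lin_dep (residue_ring (int p)) (Fp_space p) (binomial_vector p ` G)"
proof -
  interpret residues_prime p "residue_ring (int p)"
    using assms(1) by unfold_locales auto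
  interpret V: vectorspace "residue_ring (int p)" "Fp_space p"
    using assms(1) by (rule vectorspace_Fp_space)
  have p: "p > 1" using assms(1) by (rule prime_gt_1_nat)
  show B: "binomial_vector p ` G \<subseteq> carrier (Fp_space p)"
    using p unfolding carrier_Fp_space [OF assms(1)] binomial_vector_def
    by (intro image_subsetI) (simp add: restrict_PiE_iff)
  show "\<not> V.lin_dep (binomial_vector p ` G)"
  proof
    assume "V.lin_dep (binomial_vector p ` G)"
    then obtain A a v where A: "finite A" "A \<subseteq> binomial_vector p ` G"
      "a \<in> A \<rightarrow> carrier (residue_ring (int p))"
      "V.lincomb a A = \<zero>\<^bsub>Fp_space p\<^esub>" "v \<in> A" "a v \<noteq> \<zero>\<^bsub>residue_ring (int p)\<^esub>"
      unfolding V.lin_dep_def by blast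
    define P where "P m \<longleftrightarrow> m \<in> G \<and> binomial_vector p m \<in> A \<and> a (binomial_vector p m) \<noteq> 0" for m
    obtain m0 where "m0 \<in> G" "v = binomial_vector p m0"
      using A(2,5) by blast
    then have "P m0"
      using A(5,6) unfolding P_def res_zero_eq by simp
    then have "\<exists>m. P m" ..
    then have "P (LEAST m. P m)" by (rule LeastI_ex)
    moreover define m where "m = (LEAST m. P m)"
    ultimately have m: "P m" by simp
    have least: "m \<le> m'" if "P m'" for m'
      using that unfolding m_def by (rule Least_le)
    have mp: "m < p" using m assms(2) by (auto simp: P_def)
    have "a w * w m = 0" if w: "w \<in> A - {binomial_vector p m}" for w
    proof -
      obtain m' where m': "m' \<in> G" "w = binomial_vector p m'" using w A(2) by blast
      show ?thesis
      proof (cases "a w = 0")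
        case False
        then have "m \<le> m'" using least m' w by (auto simp: P_def)
        moreover have "m \<noteq> m'" using m' w by auto
        ultimately show ?thesis
          using m' assms(2) binomial_vector_diagonal(2) [of m' p m] by auto
      qed simp
    qed
    then have "(\<Sum>w\<in>A. a w * w m) = a (binomial_vector p m) * binomial_vector p m m"
      using m A(1)
      by (subst sum.remove [of _ "binomial_vector p m"]) (simp_all add: P_def sum.neutral del: mult_eq_0_iff)
    also have "\<dots> = a (binomial_vector p m)"
      using binomial_vector_diagonal(1) [OF mp] p by simp
    finally have "V.lincomb a A m = a (binomial_vector p m) mod int p"
      using lincomb_Fp_space [OF assms(1) A(1) _ A(3) mp] A(2) B by auto
    moreover have "V.lincomb a A m = 0"
      using A(4) mp by (simp add: Fp_space_def func_space_def res_zero_eq)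
    moreover have "a (binomial_vector p m) \<in> {0..int p - 1}"
      using A(3) m by (auto simp: P_def res_carrier_eq)
    ultimately show False using m by (simp add: P_def)
  qed
qed

section \<open>Counting the residues that occur\<close>

text \<open>
  A component is read off in windows of \<open>p\<close> coefficients, and each window lies below \<open>X\<^sup>N\<close> for some \<open>N\<close> in
  the hypothesis.
\<close>

lemma lacks_residue_cong:
  assumes "\<And>M. \<exists>N\<ge>M. fps_ideal.eqv p N (of_int c * f) (\<Sum>n<N. of_int (d n) * g n)"
    and "coprime c (int p)"
    and "\<And>n. \<not> int p dvd d n \<Longrightarrow> lacks_residue p m (g n)"
  shows "lacks_residue p m f"
  unfolding lacks_residue_def
proof
  fix n
  let ?L = "\<lambda>f. \<Sum>j<p. int (j choose m) * fps_nth f (p * n + j)"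
  obtain N where N: "N \<ge> p * n + p"
    "fps_ideal.eqv p N (of_int c * f) (\<Sum>n<N. of_int (d n) * g n)"
    using assms(1) by blast
  have scale: "fps_nth (of_int b * h) k = b * fps_nth h k" for b k and h :: "int fps"
    by (simp add: fps_of_int [symmetric])
  have "c * ?L f = ?L (of_int c * f)"
    unfolding scale by (simp add: sum_distrib_left mult_ac)
  also have "[\<dots> = ?L (\<Sum>n<N. of_int (d n) * g n)] (mod int p)"
    using N by (intro cong_sum cong_mult cong_refl) (simp add: fps_ideal_eqv_iff)
  also have "?L (\<Sum>n<N. of_int (d n) * g n) = (\<Sum>k<N. d k * ?L (g k))"
    unfolding fps_sum_nth scale sum_distrib_left
    by (subst sum.swap) (simp add: mult_ac)
  also have "[\<dots> = (\<Sum>k<N. 0)] (mod int p)"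
  proof (rule cong_sum)
    fix k
    show "[d k * ?L (g k) = 0] (mod int p)"
    proof (cases "int p dvd d k")
      case True
      then show ?thesis by (simp add: cong_0_iff)
    next
      case False
      then have "[?L (g k) = 0] (mod int p)"
        using assms(3) unfolding lacks_residue_def by blast
      then show ?thesis
        unfolding cong_0_iff by (rule dvd_mult)
    qed
  qed
  finally show "[?L f = 0] (mod int p)"
    using assms(2) by (simp add: cong_0_iff coprime_commute coprime_dvd_mult_right_iff)
qed

lemma lacks_residue_fishburn:
  assumes "prime p" "odd p" "m < p"
    and "\<And>n. \<not> int p dvd 6 * int n + 1 \<Longrightarrow> \<not> [r * int (pentagonal n) = int m] (mod int p)"
  shows "lacks_residue p m (fishburn_F (one_minus_q_powi r))"
proof (rule lacks_residue_cong)
  fix M :: nat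
  have p: "p > 1" using assms(1) by (rule prime_gt_1_nat)
  have "M \<le> p ^ Suc M"
    using power_gt_expt [of p "Suc M"] p by simp
  moreover have "fps_ideal.eqv p (p ^ Suc M) (of_int 2 * fishburn_F (one_minus_q_powi r))
     (\<Sum>n<p ^ Suc M. of_int (- ((- 1) ^ n * (6 * int n + 1))) * one_minus_q_powi (r * int (pentagonal n)))"
    using strange_congruence [OF assms(1,2) one_minus_q_powi_nth_0 [of r] zero_less_Suc [of M]]
    by (simp add: sum_negf [symmetric] one_minus_q_powi_mult)
  ultimately show "\<exists>N\<ge>M. fps_ideal.eqv p N (of_int 2 * fishburn_F (one_minus_q_powi r))
     (\<Sum>n<N. of_int (- ((- 1) ^ n * (6 * int n + 1))) * one_minus_q_powi (r * int (pentagonal n)))"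
    by blast
next
  show "coprime 2 (int p)" using assms(2) by simp
next
  fix n
  assume "\<not> int p dvd - ((- 1) ^ n * (6 * int n + 1))"
  then have "\<not> int p dvd 6 * int n + 1" by auto
  then show "lacks_residue p m (one_minus_q_powi (r * int (pentagonal n)))"
    by (intro lacks_residue_one_minus_q_powi assms)
qed

text \<open>
  One of \<open>x\<close> and \<open>-x\<close> has its residue in the lower half, so there are at most \<open>(p-1)/2\<close> nonzero squares.
\<close>

lemma exists_small_square_root:
  assumes "odd p" "\<not> int p dvd x"
  shows "\<exists>z\<in>{1..(p - 1) div 2}. [(int z)\<^sup>2 = x\<^sup>2] (mod int p)"
proof -
  define y where "y = x mod int p"
  have p: "p > 0" using assms(1) by (cases p) auto
  have y: "0 < y" "y < int p"
  proof -
    have "0 \<le> y" "y \<noteq> 0"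
      using p assms(2) by (simp_all add: y_def dvd_eq_mod_eq_0)
    then show "0 < y" by simp
    show "y < int p" using p by (simp add: y_def)
  qed
  have yx: "[y = x] (mod int p)"
    by (simp add: y_def)
  show ?thesis
  proof (cases "y \<le> int ((p - 1) div 2)")
    case True
    then have "nat y \<in> {1..(p - 1) div 2}"
      using y by (simp add: nat_le_iff le_nat_iff)
    then show ?thesis
      using y cong_pow [OF yx, of 2] by (intro bexI [of _ "nat y"]) simp_all
  next
    case False
    have "[int p - y = - x] (mod int p)"
      using cong_diff [OF _ yx, of "int p" 0] by (simp add: cong_def)
    then have "[(int p - y)\<^sup>2 = (- x)\<^sup>2] (mod int p)"
      by (rule cong_pow)
    moreover have "nat (int p - y) \<in> {1..(p - 1) div 2}" "int (nat (int p - y)) = int p - y"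
    proof -
      have "int ((p - 1) div 2) * 2 + 1 = int p"
        using assms(1) by (elim oddE) simp
      then have "nat (int p - y) \<le> (p - 1) div 2"
        using False y by linarith
      then show "nat (int p - y) \<in> {1..(p - 1) div 2}"
        using y by simp
      show "int (nat (int p - y)) = int p - y"
        using y by simp
    qed
    ultimately show ?thesis
      by (intro bexI [of _ "nat (int p - y)"]) simp_all
  qed
qed

theorem corollary1p7:
  fixes p :: nat and r :: int
  assumes "prime p" and "p \<ge> 5" and "r \<noteq> 0" and "coprime r (int p)"
  shows "\<exists>B. B \<subseteq> carrier (Fp_space p)
           \<and> \<not> module.lin_dep (residue_ring (int p)) (Fp_space p) B
           \<and> finite B \<and> card B \<ge> (p + 1) div 2
           \<and> (\<forall>\<alpha>\<in>B. \<forall>n. [(\<Sum>j<p. \<alpha> j * fishburn r (p * n + j)) = 0] (mod int p))"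
proof -
  have p: "p > 1" "odd p"
    using assms(1,2) prime_odd_nat [of p] by auto
  have "\<not> p dvd 24"
  proof
    assume "p dvd 24"
    also have "(24::nat) = 2 ^ 3 * 3" by simp
    finally have "p dvd 2 \<or> p dvd 3"
      using assms(1) by (metis prime_dvd_mult_iff prime_dvd_power)
    then show False
      using assms(2) by (auto dest!: dvd_imp_le)
  qed
  then have "coprime 24 p"
    using assms(1) by (simp add: coprime_commute prime_imp_coprime)
  then have "coprime (int 24) (int p)"
    by (simp only: coprime_int_iff)
  then have "\<exists>c. [int 24 * c = 1] (mod int p)"
    by (rule cong_solve_coprime_int)
  then obtain c where c: "[24 * c = 1] (mod int p)"
    by auto
  \<comment> \<open>\<open>\<phi> z\<close> is the residue of \<open>r n(3n+1)/2 = r ((6n+1)\<^sup>2 - 1) / 24\<close> when \<open>(6n+1)\<^sup>2 \<equiv> z\<^sup>2\<close>.\<close>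
  define \<phi> where "\<phi> z = nat (c * r * ((int z)\<^sup>2 - 1) mod int p)" for z
  define G where "G = {..<p} - \<phi> ` {1..(p - 1) div 2}"
  define B where "B = binomial_vector p ` G"
  have G: "G \<subseteq> {..<p}" by (simp add: G_def)
  have "card (\<phi> ` {1..(p - 1) div 2}) \<le> (p - 1) div 2"
    using card_image_le [of "{1..(p - 1) div 2}" \<phi>] by simp
  moreover have "card {..<p} - card (\<phi> ` {1..(p - 1) div 2}) \<le> card G"
    unfolding G_def by (rule diff_card_le_card_Diff) simp
  ultimately have "card G \<ge> (p + 1) div 2"
    using p by (auto elim!: oddE)
  then have card: "card B \<ge> (p + 1) div 2"
    unfolding B_def using inj_on_subset [OF inj_on_binomial_vector [OF p(1)] G] by (simp add: card_image)
  have ann: "lacks_residue p m (fishburn_F (one_minus_q_powi r))" if "m \<in> G" for m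
  proof (rule lacks_residue_fishburn [OF assms(1) p(2)])
    show "m < p" using that G by auto
    fix n
    assume "\<not> int p dvd 6 * int n + 1"
    then obtain z where z: "z \<in> {1..(p - 1) div 2}" "[(int z)\<^sup>2 = (6 * int n + 1)\<^sup>2] (mod int p)"
      using exists_small_square_root [OF p(2)] by blast
    show "\<not> [r * int (pentagonal n) = int m] (mod int p)"
    proof
      assume m: "[r * int (pentagonal n) = int m] (mod int p)"
      have "[c * r * ((int z)\<^sup>2 - 1) = c * r * ((6 * int n + 1)\<^sup>2 - 1)] (mod int p)"
        by (intro cong_mult cong_diff cong_refl z)
      also have "c * r * ((6 * int n + 1)\<^sup>2 - 1) = 24 * c * (r * int (pentagonal n))"
        unfolding pentagonal_square [symmetric] by (simp add: mult_ac)
      also have "[24 * c * (r * int (pentagonal n)) = 1 * int m] (mod int p)"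
        by (intro cong_mult c m)
      finally have "c * r * ((int z)\<^sup>2 - 1) mod int p = int m"
        using \<open>m < p\<close> by (simp add: cong_def)
      then have "m = \<phi> z" by (simp add: \<phi>_def)
      then show False using z(1) that by (simp add: G_def)
    qed
  qed
  have "[(\<Sum>j<p. \<alpha> j * fishburn r (p * n + j)) = 0] (mod int p)" if \<alpha>: "\<alpha> \<in> B" for \<alpha> n
  proof -
    obtain m where m: "m \<in> G" "\<alpha> = binomial_vector p m"
      using \<alpha> unfolding B_def by blast
    have "[(\<Sum>j<p. \<alpha> j * fishburn r (p * n + j))
        = (\<Sum>j<p. int (j choose m) * fishburn r (p * n + j))] (mod int p)"
      by (intro cong_sum cong_mult cong_refl) (simp add: m(2) binomial_vector_def)
    also have "[(\<Sum>j<p. int (j choose m) * fishburn r (p * n + j)) = 0] (mod int p)"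
      using ann [OF m(1)] unfolding lacks_residue_def fishburn_def by blast
    finally show ?thesis .
  qed
  moreover have "finite B"
    unfolding B_def using finite_subset [OF G] by simp
  ultimately show ?thesis
    using lin_indpt_binomial_vector [OF assms(1) G, folded B_def] card by (intro exI [of _ B]) simp
qed

end
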